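(* Let $G$ be a finite connected graph of order $n$ with minimum degree $\delta \geq 2$, and let $\rho(G)$ denote its packing number. Then $$\gamma_{s}(G)\leq n-2\left\lfloor\frac{2\rho(G)+\delta-2}{2}\right\rfloor .$$ Moreover, the bound is sharp: for every $n\geq 3$ equality holds for the complete graph $K_n$.
   Context: A set $B\subseteq V(G)$ is a packing if $N[u]\cap N[v]=\emptyset$ for all distinct $u,v\in B$, where $N[v]$ is the closed neighborhood of $v$; $\rho(G)$ is the maximum cardinality of a packing. A signed dominating function (SDF) of $G$ is a function $f:V(G)\to\{-1,1\}$ with $f(N[v])=\sum_{u\in N[v]}f(u)\geq 1$ for every vertex $v$. The signed domination number $\gamma_s(G)$ is the minimum of $f(V(G))=\sum_{v\in V(G)} f(v)$ over all SDFs $f$ of $G$. *)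

theory Defs
  imports Complex_Main "Graph_Theory.Graph_Theory"
begin

text \<open>
  Finite simple graphs are the library's \<^locale>\<open>graph\<close>s: finite symmetric digraphs without loops
  and multiple arcs. Each edge is represented by its two opposite arcs, so the degree of a vertex
  is its \<^const>\<open>out_degree\<close>.
\<close>

definition closed_nbhd :: "('a, 'b) pre_digraph \<Rightarrow> 'a \<Rightarrow> 'a set" where
  "closed_nbhd G v = insert v {u. v \<rightarrow>\<^bsub>G\<^esub> u}"

definition min_degree :: "('a, 'b) pre_digraph \<Rightarrow> nat" where
  "min_degree G = Min (out_degree G ` verts G)"

definition packing :: "('a, 'b) pre_digraph \<Rightarrow> 'a set \<Rightarrow> bool" where
  "packing G B \<longleftrightarrow> B \<subseteq> verts G \<and>
     (\<forall>u\<in>B. \<forall>v\<in>B. u \<noteq> v \<longrightarrow> closed_nbhd G u \<inter> closed_nbhd G v = {})"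

definition packing_number :: "('a, 'b) pre_digraph \<Rightarrow> nat" where
  "packing_number G = Max {card B | B. packing G B}"

text \<open>
  Values of \<open>f\<close> outside \<^term>\<open>verts G\<close> are unconstrained and never contribute to a sum below.
\<close>

definition signed_dominating :: "('a, 'b) pre_digraph \<Rightarrow> ('a \<Rightarrow> int) \<Rightarrow> bool" where
  "signed_dominating G f \<longleftrightarrow>
     (\<forall>v\<in>verts G. f v \<in> {-1, 1}) \<and> (\<forall>v\<in>verts G. (\<Sum>u\<in>closed_nbhd G v. f u) \<ge> 1)"

definition signed_domination_number :: "('a, 'b) pre_digraph \<Rightarrow> int" where
  "signed_domination_number G = Min {\<Sum>v\<in>verts G. f v | f. signed_dominating G f}"

text \<open>
  The sets under \<^const>\<open>Max\<close> and \<^const>\<open>Min\<close> are finite and nonempty for every finite simple graph,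
  so the extrema are attained.
\<close>

lemma (in graph) packing_sizes:
  "finite {card B | B. packing G B}" "{card B | B. packing G B} \<noteq> {}"
proof -
  have "{card B | B. packing G B} \<subseteq> card ` Pow (verts G)"
    by (auto simp: packing_def)
  then show "finite {card B | B. packing G B}"
    by (rule finite_subset) simp
  have "packing G {}" by (simp add: packing_def)
  then show "{card B | B. packing G B} \<noteq> {}" by blast
qed

lemma (in graph) closed_nbhd_subset: "v \<in> verts G \<Longrightarrow> closed_nbhd G v \<subseteq> verts G"
  by (auto simp: closed_nbhd_def dest: adj_in_verts)

lemma (in graph) signed_weights:
  "finite {\<Sum>v\<in>verts G. f v | f. signed_dominating G f}"
  "{\<Sum>v\<in>verts G. f v | f. signed_dominating G f} \<noteq> {}"
proof -
  let ?n = "int (card (verts G))"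
  have "(\<Sum>v\<in>verts G. f v) \<in> {-?n..?n}" if "signed_dominating G f" for f
  proof -
    have *: "-1 \<le> f v" "f v \<le> 1" if "v \<in> verts G" for v
      using that \<open>signed_dominating G f\<close> by (auto simp: signed_dominating_def)
    show ?thesis
      using sum_bounded_below[of "verts G" "-1" f] sum_bounded_above[of "verts G" f 1] * by simp
  qed
  then have "{\<Sum>v\<in>verts G. f v | f. signed_dominating G f} \<subseteq> {-?n..?n}" by blast
  then show "finite {\<Sum>v\<in>verts G. f v | f. signed_dominating G f}"
    by (rule finite_subset) simp
  have "signed_dominating G (\<lambda>_. 1)"
  proof -
    have "card (closed_nbhd G v) > 0" if "v \<in> verts G" for v
      using finite_subset[OF closed_nbhd_subset[OF that]]
      by (auto simp: card_gt_0_iff closed_nbhd_def)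
    then show ?thesis by (force simp: signed_dominating_def)
  qed
  then show "{\<Sum>v\<in>verts G. f v | f. signed_dominating G f} \<noteq> {}" by blast
qed

text \<open>\<^const>\<open>complete_digraph\<close> is a predicate; complete graphs of every order exist.\<close>

lemma complete_digraph_exists:
  "complete_digraph n (with_proj \<lparr>pverts = {..<n}, parcs = {(u, v). u < n \<and> v < n \<and> u \<noteq> v}\<rparr>)"
  by (auto simp: complete_digraph_pair_def)

end

theory Submission
  imports Defs
begin

text \<open>
  Every closed neighbourhood meets a packing in at most one vertex. Hence, adding to a maximum
  packing any \<open>\<delta> div 2 - 1\<close> further vertices gives a set that meets every closed neighbourhood in
  at most \<open>\<delta> div 2\<close> vertices, and the function that is \<open>-1\<close> exactly on this set is signed
  dominating. In a complete graph the sum over a closed neighbourhood is the total weight, which is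
  positive and has the parity of \<open>n\<close>.
\<close>

text \<open>The integer \<open>p - 1\<close> comes out of the floor, and what is left is the floor
  of half of \<open>d\<close>. After this rewriting, the rest of the proof is integer
  arithmetic.\<close>

lemma floor_half_packing_degree:
  "\<lfloor>(2 * real p + real d - 2) / 2\<rfloor> = int p - 1 + int (d div 2)"
proof -
  have "real d = 2 * real (d div 2) + real (d mod 2)"
    by (metis mult_div_mod_eq of_nat_add of_nat_mult of_nat_numeral)
  moreover have "real (d mod 2) < 2"
    by (metis mod_less_divisor of_nat_less_iff of_nat_numeral pos2)
  ultimately show ?thesis
    by (intro floor_unique) auto
qed

text \<open>Switching a value from 1 to -1 costs 2. This is applied both to closed neighbourhoods
  and to the whole vertex set.\<close>

lemma sum_minus_one_on:
  assumes "finite A"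
  shows "(\<Sum>v\<in>A. if v \<in> M then - 1 else 1 :: int) = int (card A) - 2 * int (card (A \<inter> M))"
proof -
  have "(\<Sum>v\<in>A. if v \<in> M then - 1 else 1 :: int) = - int (card (A \<inter> M)) + int (card (A \<inter> - M))"
    using assms by (simp add: sum.If_cases)
  moreover have "card A = card (A \<inter> M) + card (A \<inter> - M)"
    using card_Int_Diff [OF assms, of M] by (simp add: Diff_eq)
  ultimately show ?thesis by simp
qed

context graph
begin

lemma finite_closed_nbhd [simp]: "v \<in> verts G \<Longrightarrow> finite (closed_nbhd G v)"
  by (rule finite_subset [OF closed_nbhd_subset finite_verts])

lemma closed_nbhd_sym: "u \<in> closed_nbhd G v \<longleftrightarrow> v \<in> closed_nbhd G u"
  by (auto simp: closed_nbhd_def intro: arcs_ends_symmetric [OF sym_arcs])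

text \<open>\<open>out_degree\<close> counts arcs rather than neighbours. The two agree because,
  without multiple arcs, \<open>head\<close> is injective on the arcs leaving
  \<open>v\<close>.\<close>

lemma card_nbhd: "card {u. v \<rightarrow>\<^bsub>G\<^esub> u} = out_degree G v"
proof -
  have "{u. v \<rightarrow>\<^bsub>G\<^esub> u} = head G ` out_arcs G v"
    by (auto simp: arcs_ends_conv)
  moreover have "inj_on (head G) (out_arcs G v)"
    by (auto simp: inj_on_def arc_to_ends_def intro: no_multi_arcs)
  ultimately show ?thesis
    by (simp add: card_image out_degree_def)
qed

lemma not_adj_self: "\<not> v \<rightarrow>\<^bsub>G\<^esub> v"
  using no_loops by (auto simp: arcs_ends_conv)

lemma card_closed_nbhd:
  assumes "v \<in> verts G"
  shows "card (closed_nbhd G v) = Suc (out_degree G v)"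
proof -
  have "finite {u. v \<rightarrow>\<^bsub>G\<^esub> u}"
    using finite_closed_nbhd [OF assms] by (simp add: closed_nbhd_def)
  then show ?thesis
    by (simp add: closed_nbhd_def card_nbhd not_adj_self)
qed

lemma min_degree_le: "v \<in> verts G \<Longrightarrow> min_degree G \<le> out_degree G v"
  by (simp add: min_degree_def)

lemma obtain_maximum_packing:
  obtains B where "packing G B" "card B = packing_number G"
proof -
  have "packing_number G \<in> {card B | B. packing G B}"
    unfolding packing_number_def by (rule Max_in [OF packing_sizes])
  then show ?thesis by (elim CollectE exE conjE) (rule that, simp_all)
qed

lemma packing_number_ge: "packing G B \<Longrightarrow> card B \<le> packing_number G"
  unfolding packing_number_def by (intro Max_ge [OF packing_sizes(1)] CollectI exI [of _ B]) simp

lemma packing_number_pos: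
  assumes "verts G \<noteq> {}"
  shows "packing_number G \<ge> 1"
proof -
  obtain v where "v \<in> verts G" using assms by blast
  then have "packing G {v}" by (simp add: packing_def)
  from packing_number_ge [OF this] show ?thesis by simp
qed

text \<open>If two members of the packing lay in the closed neighbourhood of \<open>v\<close>, then
  by symmetry \<open>v\<close> would lie in both of their closed neighbourhoods, which are
  disjoint.\<close>

lemma card_closed_nbhd_Int_packing:
  assumes "packing G B"
  shows "card (closed_nbhd G v \<inter> B) \<le> 1"
proof -
  have "x = y" if "x \<in> closed_nbhd G v \<inter> B" "y \<in> closed_nbhd G v \<inter> B" for x y
    using that assms closed_nbhd_sym [of _ v] unfolding packing_def by blast
  \<comment> \<open>An infinite intersection is harmless, since its \<open>card\<close> is 0 by
    default.\<close>
  then show ?thesis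
    by (metis One_nat_def card.infinite card_le_Suc0_iff_eq zero_le)
qed

lemma signed_domination_number_le:
  "signed_dominating G f \<Longrightarrow> signed_domination_number G \<le> (\<Sum>v\<in>verts G. f v)"
  unfolding signed_domination_number_def by (intro Min_le [OF signed_weights(1)] CollectI exI [of _ f]) simp

lemma obtain_minimum_signed_dominating:
  obtains f where "signed_dominating G f" "(\<Sum>v\<in>verts G. f v) = signed_domination_number G"
proof -
  have "signed_domination_number G \<in> {\<Sum>v\<in>verts G. f v | f. signed_dominating G f}"
    unfolding signed_domination_number_def by (rule Min_in [OF signed_weights])
  then show ?thesis by (elim CollectE exE conjE) (rule that, simp_all)
qed

lemma signed_domination_number_le_packing:
  assumes ne: "verts G \<noteq> {}" and deg: "min_degree G \<ge> 2"
  shows "signed_domination_number G \<le>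
    int (card (verts G)) - 2 * (int (packing_number G) - 1 + int (min_degree G div 2))"
proof -
  define k where "k = min_degree G div 2"
  \<comment> \<open>This makes the truncated difference \<open>k - 1\<close> on naturals a true
    one.\<close>
  have "k \<ge> 1" using deg by (simp add: k_def)
  obtain B where B: "packing G B" "card B = packing_number G"
    by (rule obtain_maximum_packing)
  have BV: "B \<subseteq> verts G" using B by (simp add: packing_def)
  then have "finite B" by (rule finite_subset) simp
  have "B \<noteq> {}" using packing_number_pos [OF ne] B(2) by auto
  then obtain b where b: "b \<in> B" by blast
  \<comment> \<open>The extra vertices are taken among the neighbours of one packing vertex
    \<open>b\<close>: there are at least \<delta> of them, and none is in the packing, so no further
    count is needed to find room for \<open>C\<close>.\<close>
  have "k - 1 \<le> card {u. b \<rightarrow>\<^bsub>G\<^esub> u}"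
    using min_degree_le [of b] b BV by (auto simp: k_def card_nbhd)
  then obtain C where C: "C \<subseteq> {u. b \<rightarrow>\<^bsub>G\<^esub> u}" "card C = k - 1" "finite C"
    by (rule obtain_subset_with_card_n)
  have CV: "C \<subseteq> verts G" using C(1) by (auto dest: adj_in_verts)
  have "B \<inter> C = {}"
  proof -
    \<comment> \<open>A neighbour \<open>c\<close> of \<open>b\<close> lies in the closed
      neighbourhoods of both \<open>b\<close> and \<open>c\<close>.\<close>
    have "c = b" if "c \<in> B" "b \<rightarrow>\<^bsub>G\<^esub> c" for c
      using that b B(1) unfolding packing_def closed_nbhd_def by blast
    then show ?thesis using C(1) not_adj_self by blast
  qed
  define M where "M = B \<union> C"
  have "card M = packing_number G + (k - 1)"
    using \<open>B \<inter> C = {}\<close> \<open>finite B\<close> C B(2) by (simp add: M_def card_Un_disjoint)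
  have "verts G \<inter> M = M" using BV CV by (auto simp: M_def)
  define f where "f = (\<lambda>v. if v \<in> M then - 1 else 1 :: int)"
  have "signed_dominating G f"
    unfolding signed_dominating_def
  proof (intro conjI ballI)
    fix v assume v: "v \<in> verts G"
    have "card (closed_nbhd G v \<inter> M) \<le> card (closed_nbhd G v \<inter> B) + card (closed_nbhd G v \<inter> C)"
      unfolding M_def Int_Un_distrib by (rule card_Un_le)
    also have "\<dots> \<le> 1 + card C"
      using card_closed_nbhd_Int_packing [OF B(1)] C(3) by (intro add_mono card_mono) auto
    finally have "card (closed_nbhd G v \<inter> M) \<le> k"
      using C(2) \<open>k \<ge> 1\<close> by simp
    \<comment> \<open>The closed neighbourhood thus has at least 2k + 1 vertices, at most k of them
      with value -1, so its sum is at least (2k + 1) - 2k = 1.\<close>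
    moreover have "2 * k \<le> out_degree G v"
      using min_degree_le [OF v] by (simp add: k_def)
    ultimately show "1 \<le> (\<Sum>u\<in>closed_nbhd G v. f u)"
      using v by (simp add: f_def sum_minus_one_on card_closed_nbhd)
  qed (simp add: f_def)
  from signed_domination_number_le [OF this] show ?thesis
    using \<open>card M = _\<close> \<open>k \<ge> 1\<close> \<open>verts G \<inter> M = M\<close> by (simp add: f_def sum_minus_one_on k_def)
qed

text \<open>Each term 1 - f(v) is 0 or 2 for an optimal f.\<close>

lemma signed_domination_number_parity:
  "even (int (card (verts G)) - signed_domination_number G)"
proof -
  obtain f where f: "signed_dominating G f" "(\<Sum>v\<in>verts G. f v) = signed_domination_number G"
    by (rule obtain_minimum_signed_dominating)
  have "int (card (verts G)) - signed_domination_number G = (\<Sum>v\<in>verts G. 1 - f v)"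
    by (simp add: sum_subtractf f(2))
  moreover have "even (\<Sum>v\<in>verts G. 1 - f v)"
    using f(1) by (intro dvd_sum) (auto simp: signed_dominating_def)
  ultimately show ?thesis by simp
qed

end

lemma complete_digraph_closed_nbhd:
  assumes "complete_digraph n K" "v \<in> verts K"
  shows "closed_nbhd K v = verts K"
  using assms by (auto simp: complete_digraph_def closed_nbhd_def)

lemma complete_digraph_min_degree:
  assumes K: "complete_digraph n K" and "n \<ge> 1"
  shows "min_degree K = n - 1"
proof -
  interpret graph K using K by (simp add: complete_digraph_def)
  have n: "card (verts K) = n" using K by (simp add: complete_digraph_def)
  have "out_degree K v = n - 1" if "v \<in> verts K" for v
    using card_closed_nbhd [OF that] complete_digraph_closed_nbhd [OF K that] n by simp
  moreover have "verts K \<noteq> {}" using n \<open>n \<ge> 1\<close> by auto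
  ultimately have "out_degree K ` verts K = {n - 1}" by auto
  then show ?thesis by (simp add: min_degree_def)
qed

text \<open>Every closed neighbourhood is the whole vertex set, so the domination condition at any
  one vertex already bounds the total weight.\<close>

lemma complete_digraph_signed_domination_number_pos:
  assumes K: "complete_digraph n K" and "n \<ge> 1"
  shows "signed_domination_number K \<ge> 1"
proof -
  interpret graph K using K by (simp add: complete_digraph_def)
  have "verts K \<noteq> {}" using K \<open>n \<ge> 1\<close> by (auto simp: complete_digraph_def)
  then obtain v where "v \<in> verts K" by blast
  obtain f where "signed_dominating K f" "(\<Sum>v\<in>verts K. f v) = signed_domination_number K"
    by (rule obtain_minimum_signed_dominating)
  then show ?thesis
    using \<open>v \<in> verts K\<close> complete_digraph_closed_nbhd [OF K \<open>v \<in> verts K\<close>]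
    by (auto simp: signed_dominating_def)
qed

theorem theorem2p1:
  shows "(\<forall>G :: ('a, 'b) pre_digraph.
            graph G \<and> Digraph_Component.connected G \<and> min_degree G \<ge> 2 \<longrightarrow>
            signed_domination_number G \<le>
              int (card (verts G))
              - 2 * \<lfloor>(2 * real (packing_number G) + real (min_degree G) - 2) / 2\<rfloor>)
       \<and> (\<forall>n \<ge> 3. \<forall>K :: ('c, 'd) pre_digraph. complete_digraph n K \<longrightarrow>
            signed_domination_number K =
              int n - 2 * \<lfloor>(2 * real (packing_number K) + real (min_degree K) - 2) / 2\<rfloor>)"
  unfolding floor_half_packing_degree
proof (intro conjI allI impI; (elim conjE)?)
  fix G :: "('a, 'b) pre_digraph"
  assume "graph G" "Digraph_Component.connected G" "min_degree G \<ge> 2"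
  \<comment> \<open>The library's notion of connectedness includes having a vertex.\<close>
  moreover from this have "verts G \<noteq> {}"
    by (simp add: Digraph_Component.connected_def strongly_connected_def)
  ultimately show "signed_domination_number G \<le>
      int (card (verts G)) - 2 * (int (packing_number G) - 1 + int (min_degree G div 2))"
    by (intro graph.signed_domination_number_le_packing)
next
  fix n and K :: "('c, 'd) pre_digraph"
  assume n: "n \<ge> 3" and K: "complete_digraph n K"
  interpret graph K using K by (simp add: complete_digraph_def)
  have card: "card (verts K) = n" using K by (simp add: complete_digraph_def)
  then have ne: "verts K \<noteq> {}" using n by auto
  have deg: "min_degree K = n - 1" using complete_digraph_min_degree [OF K] n by simp
  obtain m where m: "int n - signed_domination_number K = 2 * m"
    using signed_domination_number_parity unfolding card by (rule evenE)
  have "2 * m \<le> int (n - 1)"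
    using complete_digraph_signed_domination_number_pos [OF K] m n by simp
  \<comment> \<open>Integrality of \<open>m\<close> gains the rounding down that matches the floor
    in the bound, since \<delta> = n - 1.\<close>
  then have "m \<le> int ((n - 1) div 2)" by (simp add: zdiv_int)
  \<comment> \<open>The estimate \<rho> \<ge> 1 suffices here, because the right-hand side decreases
    as \<rho> grows.\<close>
  then have "signed_domination_number K \<ge>
      int n - 2 * (int (packing_number K) - 1 + int (min_degree K div 2))"
    using m packing_number_pos [OF ne] deg by simp
  moreover have "signed_domination_number K \<le>
      int n - 2 * (int (packing_number K) - 1 + int (min_degree K div 2))"
    using signed_domination_number_le_packing [OF ne] deg n card by simp
  ultimately show "signed_domination_number K =
      int n - 2 * (int (packing_number K) - 1 + int (min_degree K div 2))"
    by simp
qed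

end
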